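(* Consider the Nash bargaining problem (NBP) defined in the context. The objective function $\Phi$ of (NBP) is maximized if and only if, for each source $s_i$, $1\le i\le N$, one has $P_i^{s1}=P_0^s$ or $P_i^{s1}=0$. That is to say, each source in the system is either a dedicator or an enjoyer, where source $s_i$ is called a dedicator when it transmits energy with full transmission power, i.e. $P_i^{s1}=P_0^s$, and an enjoyer when it never transmits energy to the relay, i.e. $P_i^{s1}=0$.
   Context: Parameters: an integer $N\ge 1$ (number of source-destination pairs $(s_i,d_i)$, served by one relay $r$), real constants $T>0$ (block time), $P_0^s>0$ and $P_0^r>0$ (maximum transmission power of each source and of the relay), $\sigma^2>0$ (noise power), $\eta\in(0,1)$ (energy conversion efficiency), $E_0\ge 0$ (relay energy cost for decoding and recoding), $\theta_0>0$, and channel gains $h_i$ (from $s_i$ to $r$) and $g_i$ (from $r$ to $d_i$) in $\mathbb{C}$ for $1\le i\le N$. Variables: reals $P_i^{s0},P_i^{s1},\alpha_i,\beta_i,\gamma_i$ ($1\le i\le N$) and $P^r$, with $\alpha_i,\beta_i,\gamma_i\ge 0$. Here $P_i^{s1}$ and $P_i^{s0}$ are the powers of source $s_i$ for energy transmission and for data transmission, $P^r$ is the transmission power of the relay, and $\alpha_iT$, $\beta_iT$, $\gamma_iT$ are the durations of energy transmission from $s_i$, data transmission from $s_i$ to $r$, and data forwarding from $r$ to $d_i$. Define $$C_i=\min\Big\{\beta_i\log\big(1+\tfrac{P_i^{s0}|h_i|^2}{\sigma^2}\big),\ \gamma_i\log\big(1+\tfrac{P^r|g_i|^2}{\sigma^2}\big)\Big\},\qquad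 U_i^S=\frac{C_i}{P_i^{s1}\alpha_i+P_i^{s0}\beta_i},$$ $$U^R=\eta\sum_{i=1}^N\alpha_iT P_i^{s1}|h_i|^2-\Big(\sum_{i=1}^N\gamma_iTP^r+E_0\Big).$$ (NBP): maximize $\Phi=\big(\prod_{i=1}^N U_i^S\big)U^R$ over all variables subject to $U_i^S>0$ for all $i$; $U^R>0$; $\max_i(\alpha_iT)+\sum_{i=1}^N(\beta_i+\gamma_i)T=T$; $(\beta_i+\gamma_i)T\ge\theta_0T$ for all $i$; $0\le P_i^{s1}\le P_0^s$ and $0\le P_i^{s0}\le P_0^s$ for all $i$; $0\le P^r\le P_0^r$. A maximizer is called a Nash bargaining solution.
   Formalization: The "if" direction is false as stated, since the other variables are unconstrained; it is replaced by: if every source is a dedicator or an enjoyer and the point maximizes Φ among feasible points of that kind, then it maximizes Φ over all feasible points. *)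

theory Defs
  imports Complex_Main
begin

text \<open>
  Source-destination pairs are indexed by \<open>{1..num_pairs p}\<close>; the values of all indexed
  families outside this range are irrelevant.
\<close>

record nbp_params =
  num_pairs :: nat
  block_time :: real                 \<comment> \<open>\<open>T\<close>\<close>
  max_source_power :: real           \<comment> \<open>\<open>P\<^sub>0\<^sup>s\<close>\<close>
  max_relay_power :: real            \<comment> \<open>\<open>P\<^sub>0\<^sup>r\<close>\<close>
  noise_power :: real                \<comment> \<open>\<open>\<sigma>\<^sup>2\<close>, not \<open>\<sigma>\<close>\<close>
  efficiency :: real                 \<comment> \<open>\<open>\<eta>\<close>\<close>
  relay_cost :: real                 \<comment> \<open>\<open>E\<^sub>0\<close>\<close>
  min_share :: real                  \<comment> \<open>\<open>\<theta>\<^sub>0\<close>\<close>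
  gain_sr :: "nat \<Rightarrow> complex"        \<comment> \<open>\<open>h\<^sub>i\<close>\<close>
  gain_rd :: "nat \<Rightarrow> complex"        \<comment> \<open>\<open>g\<^sub>i\<close>\<close>

record nbp_vars =
  data_power :: "nat \<Rightarrow> real"        \<comment> \<open>\<open>P\<^sub>i\<^sup>s\<^sup>0\<close>\<close>
  energy_power :: "nat \<Rightarrow> real"      \<comment> \<open>\<open>P\<^sub>i\<^sup>s\<^sup>1\<close>\<close>
  alpha :: "nat \<Rightarrow> real"
  beta :: "nat \<Rightarrow> real"
  gamma :: "nat \<Rightarrow> real"
  relay_power :: real                \<comment> \<open>\<open>P\<^sup>r\<close>\<close>

definition valid_params :: "nbp_params \<Rightarrow> bool" where
  "valid_params p \<longleftrightarrow>
     num_pairs p \<ge> 1 \<and> block_time p > 0 \<and> max_source_power p > 0 \<and> max_relay_power p > 0 \<and>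
     noise_power p > 0 \<and> 0 < efficiency p \<and> efficiency p < 1 \<and>
     relay_cost p \<ge> 0 \<and> min_share p > 0"

definition rate :: "nbp_params \<Rightarrow> nbp_vars \<Rightarrow> nat \<Rightarrow> real" where
  "rate p x i =
     min (beta x i * ln (1 + data_power x i * (cmod (gain_sr p i))\<^sup>2 / noise_power p))
         (gamma x i * ln (1 + relay_power x * (cmod (gain_rd p i))\<^sup>2 / noise_power p))"

text \<open>
  If the denominator vanishes, the quotient is \<open>0\<close>, so such points violate the constraint
  that the source utilities are positive.
\<close>

definition source_utility :: "nbp_params \<Rightarrow> nbp_vars \<Rightarrow> nat \<Rightarrow> real" where
  "source_utility p x i =
     rate p x i / (energy_power x i * alpha x i + data_power x i * beta x i)"

definition relay_utility :: "nbp_params \<Rightarrow> nbp_vars \<Rightarrow> real" where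
  "relay_utility p x =
     efficiency p *
       (\<Sum>i=1..num_pairs p. alpha x i * block_time p * energy_power x i * (cmod (gain_sr p i))\<^sup>2)
     - ((\<Sum>i=1..num_pairs p. gamma x i * block_time p * relay_power x) + relay_cost p)"

definition objective :: "nbp_params \<Rightarrow> nbp_vars \<Rightarrow> real" where
  "objective p x = (\<Prod>i=1..num_pairs p. source_utility p x i) * relay_utility p x"

definition feasible :: "nbp_params \<Rightarrow> nbp_vars \<Rightarrow> bool" where
  "feasible p x \<longleftrightarrow>
     (\<forall>i\<in>{1..num_pairs p}. alpha x i \<ge> 0 \<and> beta x i \<ge> 0 \<and> gamma x i \<ge> 0) \<and>
     (\<forall>i\<in>{1..num_pairs p}. source_utility p x i > 0) \<and>
     relay_utility p x > 0 \<and>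
     Max ((\<lambda>i. alpha x i * block_time p) ` {1..num_pairs p})
       + (\<Sum>i=1..num_pairs p. (beta x i + gamma x i) * block_time p) = block_time p \<and>
     (\<forall>i\<in>{1..num_pairs p}.
        (beta x i + gamma x i) * block_time p \<ge> min_share p * block_time p) \<and>
     (\<forall>i\<in>{1..num_pairs p}. 0 \<le> energy_power x i \<and> energy_power x i \<le> max_source_power p) \<and>
     (\<forall>i\<in>{1..num_pairs p}. 0 \<le> data_power x i \<and> data_power x i \<le> max_source_power p) \<and>
     0 \<le> relay_power x \<and> relay_power x \<le> max_relay_power p"

definition maximizes_on :: "nbp_params \<Rightarrow> nbp_vars set \<Rightarrow> nbp_vars \<Rightarrow> bool" where
  "maximizes_on p S x \<longleftrightarrow> x \<in> S \<and> (\<forall>y\<in>S. objective p y \<le> objective p x)"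

definition nash_bargaining_solution :: "nbp_params \<Rightarrow> nbp_vars \<Rightarrow> bool" where
  "nash_bargaining_solution p x \<longleftrightarrow> maximizes_on p {y. feasible p y} x"

definition dedicator :: "nbp_params \<Rightarrow> nbp_vars \<Rightarrow> nat \<Rightarrow> bool" where
  "dedicator p x i \<longleftrightarrow> energy_power x i = max_source_power p"

definition enjoyer :: "nbp_vars \<Rightarrow> nat \<Rightarrow> bool" where
  "enjoyer x i \<longleftrightarrow> energy_power x i = 0"

definition all_dedicators_or_enjoyers :: "nbp_params \<Rightarrow> nbp_vars \<Rightarrow> bool" where
  "all_dedicators_or_enjoyers p x \<longleftrightarrow> (\<forall>i\<in>{1..num_pairs p}. dedicator p x i \<or> enjoyer x i)"

end

theory Submission
  imports Defs
begin

text \<open>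
  As a function of a single \<open>P\<^sub>i\<^sup>s\<^sup>1\<close> the objective is linear-fractional, hence monotone, so moving
  \<open>P\<^sub>i\<^sup>s\<^sup>1\<close> to one of the endpoints of \<open>[0, P\<^sub>0\<^sup>s]\<close> does not decrease it; doing this for every source
  shows that the restricted and the unrestricted problem have the same supremum. A maximizer with
  an interior \<open>P\<^sub>i\<^sup>s\<^sup>1\<close> could therefore only occur when moving \<open>P\<^sub>i\<^sup>s\<^sup>1\<close> to \<open>0\<close> costs nothing. But a
  point with \<open>P\<^sub>i\<^sup>s\<^sup>1 = 0\<close> is never optimal: halving \<open>P\<^sub>i\<^sup>s\<^sup>0\<close> halves the energy spent by \<open>s\<^sub>i\<close>, while
  by strict concavity of the logarithm its rate stays above one half of its old value.
\<close>

section \<open>Changing one power of one source\<close>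

definition set_energy :: "nbp_vars \<Rightarrow> nat \<Rightarrow> real \<Rightarrow> nbp_vars" where
  "set_energy x i q = x\<lparr>energy_power := (energy_power x)(i := q)\<rparr>"

definition set_data :: "nbp_vars \<Rightarrow> nat \<Rightarrow> real \<Rightarrow> nbp_vars" where
  "set_data x i q = x\<lparr>data_power := (data_power x)(i := q)\<rparr>"

lemma set_energy_simps [simp]:
  "energy_power (set_energy x i q) = (energy_power x)(i := q)"
  "data_power (set_energy x i q) = data_power x"
  "alpha (set_energy x i q) = alpha x"
  "beta (set_energy x i q) = beta x"
  "gamma (set_energy x i q) = gamma x"
  "relay_power (set_energy x i q) = relay_power x"
  by (simp_all add: set_energy_def)

lemma set_data_simps [simp]:
  "energy_power (set_data x i q) = energy_power x"
  "data_power (set_data x i q) = (data_power x)(i := q)"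
  "alpha (set_data x i q) = alpha x"
  "beta (set_data x i q) = beta x"
  "gamma (set_data x i q) = gamma x"
  "relay_power (set_data x i q) = relay_power x"
  by (simp_all add: set_data_def)

lemma rate_set_energy [simp]: "rate p (set_energy x i q) j = rate p x j"
  by (simp add: rate_def)

lemma source_utility_set_energy:
  "source_utility p (set_energy x i q) j =
     (if j = i then rate p x i / (q * alpha x i + data_power x i * beta x i)
      else source_utility p x j)"
  by (simp add: source_utility_def)

lemma relay_utility_set_energy:
  assumes "i \<in> {1..num_pairs p}"
  shows "relay_utility p (set_energy x i q) = relay_utility p x +
    efficiency p * alpha x i * block_time p * (cmod (gain_sr p i))\<^sup>2 * (q - energy_power x i)"
proof -
  let ?f = "\<lambda>P j. alpha x j * block_time p * P j * (cmod (gain_sr p j))\<^sup>2"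
  have "sum (?f ((energy_power x)(i := q))) ({1..num_pairs p} - {i}) =
      sum (?f (energy_power x)) ({1..num_pairs p} - {i})"
    by (rule sum.cong) auto
  then have "sum (?f ((energy_power x)(i := q))) {1..num_pairs p} =
      sum (?f (energy_power x)) {1..num_pairs p} +
      alpha x i * block_time p * (cmod (gain_sr p i))\<^sup>2 * (q - energy_power x i)"
    unfolding sum.remove[OF finite_atLeastAtMost assms, of "?f _"]
    by (simp add: algebra_simps del: fun_upd_apply add: fun_upd_same)
  then show ?thesis
    unfolding relay_utility_def set_energy_simps by (simp only:) (simp add: ring_distribs)
qed

lemma source_utility_set_data_other:
  "j \<noteq> i \<Longrightarrow> source_utility p (set_data x i q) j = source_utility p x j"
  by (simp add: source_utility_def rate_def)

lemma relay_utility_set_data [simp]: "relay_utility p (set_data x i q) = relay_utility p x"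
  by (simp add: relay_utility_def)

lemma objective_remove:
  assumes "i \<in> {1..num_pairs p}"
  shows "objective p x = source_utility p x i *
    (\<Prod>j\<in>{1..num_pairs p} - {i}. source_utility p x j) * relay_utility p x"
  using assms by (simp add: objective_def prod.remove[of _ i])

text \<open>A quotient with zero denominator is 0, so a positive source utility over a nonnegative
  denominator forces a positive rate. The first argument of the minimum in the rate is then
  positive, and it would vanish (\<open>ln 1 = 0\<close>) if the duration, the data power or the
  gain were zero.\<close>

lemma feasible_pos:
  assumes "feasible p x" "i \<in> {1..num_pairs p}"
  shows "rate p x i > 0" "beta x i > 0" "data_power x i > 0" "cmod (gain_sr p i) > 0"
    "energy_power x i * alpha x i \<ge> 0"
proof -
  have nn: "alpha x i \<ge> 0" "beta x i \<ge> 0" "data_power x i \<ge> 0" "energy_power x i \<ge> 0"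
    and U: "source_utility p x i > 0"
    using assms by (auto simp: feasible_def)
  then show "energy_power x i * alpha x i \<ge> 0" by simp
  with nn have "energy_power x i * alpha x i + data_power x i * beta x i \<ge> 0" by simp
  with U show r: "rate p x i > 0"
    by (auto simp: source_utility_def zero_less_divide_iff)
  then have *: "beta x i * ln (1 + data_power x i * (cmod (gain_sr p i))\<^sup>2 / noise_power p) > 0"
    by (simp add: rate_def)
  from * have "beta x i \<noteq> 0" "data_power x i \<noteq> 0" "cmod (gain_sr p i) \<noteq> 0" by auto
  with nn show "beta x i > 0" "data_power x i > 0" "cmod (gain_sr p i) > 0" by auto
qed

section \<open>The objective as a function of one energy power\<close>

lemma frac_le_iff:
  fixes a b c d :: real
  assumes "b > 0" "d > 0"
  shows "a / b \<le> c / d \<longleftrightarrow> a * d \<le> c * b"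
  using assms by (simp add: pos_divide_le_eq pos_le_divide_eq)

lemma frac_less_iff:
  fixes a b c d :: real
  assumes "b > 0" "d > 0"
  shows "a / b < c / d \<longleftrightarrow> a * d < c * b"
  using assms by (simp add: pos_divide_less_eq pos_less_divide_eq)

text \<open>The two cases are the two directions of monotonicity. Only the second carries a strict
  clause: a constant objective is assigned to endpoint 0, where \<open>enjoyer_not_optimal\<close>
  later supplies the strict gain.\<close>

lemma set_energy_endpoint:
  assumes x: "feasible p x" and i: "i \<in> {1..num_pairs p}"
  obtains "feasible p (set_energy x i 0)" "objective p x \<le> objective p (set_energy x i 0)"
  | "feasible p (set_energy x i (max_source_power p))"
    "objective p x \<le> objective p (set_energy x i (max_source_power p))"
    "energy_power x i < max_source_power p \<Longrightarrow>
       objective p x < objective p (set_energy x i (max_source_power p))"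
proof -
  \<comment> \<open>At power \<open>q\<close> the relay utility is \<open>R + c * (q - P)\<close>,
    the energy spent by the source is \<open>D + alpha x i * (q - P)\<close>, and \<open>K\<close>
    collects the factors that do not depend on \<open>q\<close>.\<close>
  define P where "P = energy_power x i"
  define c where "c = efficiency p * alpha x i * block_time p * (cmod (gain_sr p i))\<^sup>2"
  define D where "D = P * alpha x i + data_power x i * beta x i"
  define R where "R = relay_utility p x"
  define K where "K = rate p x i * (\<Prod>j\<in>{1..num_pairs p} - {i}. source_utility p x j)"
  note pos = feasible_pos[OF x i]
  have P: "0 \<le> P" "P \<le> max_source_power p" and R: "R > 0" and a: "alpha x i \<ge> 0"
    using x i by (auto simp: feasible_def P_def R_def)
  have D: "D > 0" using pos by (simp add: D_def P_def add_nonneg_pos)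
  have K: "K > 0" using pos x by (auto simp: K_def feasible_def intro!: mult_pos_pos prod_pos)
  have obj: "objective p (set_energy x i q) =
      K * ((R + c * (q - P)) / (D + alpha x i * (q - P)))" for q
  proof -
    have "(\<Prod>j\<in>{1..num_pairs p} - {i}. source_utility p (set_energy x i q) j) =
        (\<Prod>j\<in>{1..num_pairs p} - {i}. source_utility p x j)"
      by (rule prod.cong) (auto simp: source_utility_set_energy)
    moreover have "q * alpha x i + data_power x i * beta x i = D + alpha x i * (q - P)"
      by (simp add: D_def algebra_simps)
    ultimately show ?thesis
      using i by (simp add: objective_remove[OF i] source_utility_set_energy
          relay_utility_set_energy K_def R_def c_def P_def)
  qed
  have obj0: "objective p x = K * (R / D)"
    using obj[of P] by (simp add: P_def set_energy_def)
  \<comment> \<open>\<open>c * D - R * alpha x i\<close> is the numerator of the derivative of the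
    quotient, and it is the same for every \<open>q\<close>. Condition \<open>t\<close> says that
    \<open>q\<close> lies in a direction in which the objective does not decrease.\<close>
  have move: "feasible p (set_energy x i q) \<and> objective p x \<le> objective p (set_energy x i q) \<and>
      ((q - P) * (c * D - R * alpha x i) > 0 \<longrightarrow>
         objective p x < objective p (set_energy x i q))"
    if q: "0 \<le> q" "q \<le> max_source_power p" and t: "(q - P) * (c * D - R * alpha x i) \<ge> 0" for q
  proof -
    have Dq: "D + alpha x i * (q - P) > 0"
    proof -
      have "D + alpha x i * (q - P) = q * alpha x i + data_power x i * beta x i"
        by (simp add: D_def algebra_simps)
      then show ?thesis using pos q a by (simp add: add_nonneg_pos)
    qed
    have diff: "(R + c * (q - P)) * D - R * (D + alpha x i * (q - P)) =
        (q - P) * (c * D - R * alpha x i)"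
      by (simp add: algebra_simps)
    have le: "R / D \<le> (R + c * (q - P)) / (D + alpha x i * (q - P))"
      using diff t by (intro frac_le_iff[OF D Dq, THEN iffD2]) simp
    have less: "R / D < (R + c * (q - P)) / (D + alpha x i * (q - P))"
      if "(q - P) * (c * D - R * alpha x i) > 0"
      using diff that by (intro frac_less_iff[OF D Dq, THEN iffD2]) simp
    \<comment> \<open>Lowering \<open>q\<close> reduces the harvested energy, so positivity of the
      relay utility has to be rechecked. The quotient stays at least \<open>R / D > 0\<close> and
      its denominator is positive, hence so is its numerator.\<close>
    have "0 < (R + c * (q - P)) / (D + alpha x i * (q - P))"
      using le R D by (meson divide_pos_pos less_le_trans)
    with Dq have Rq: "R + c * (q - P) > 0" by (simp add: zero_less_divide_iff)
    have "rate p x i / (q * alpha x i + data_power x i * beta x i) > 0"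
      using pos q a by (intro divide_pos_pos add_nonneg_pos) auto
    then have "feasible p (set_energy x i q)"
      using x q Rq i
      by (auto simp: feasible_def source_utility_set_energy relay_utility_set_energy
          R_def c_def P_def)
    moreover have "objective p x \<le> objective p (set_energy x i q)"
      unfolding obj obj0 using le K by (simp del: times_divide_eq_right)
    moreover have "objective p x < objective p (set_energy x i q)"
      if "(q - P) * (c * D - R * alpha x i) > 0"
      unfolding obj obj0 using less[OF that] K by (simp del: times_divide_eq_right)
    ultimately show ?thesis by blast
  qed
  show thesis
  proof (cases "c * D - R * alpha x i \<le> 0")
    case True
    then have "(0 - P) * (c * D - R * alpha x i) \<ge> 0"
      using P by (intro mult_nonpos_nonpos) auto
    with move[of 0] P that(1) show thesis by simp
  next
    case False
    then have "(max_source_power p - P) * (c * D - R * alpha x i) \<ge> 0"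
      using P by (intro mult_nonneg_nonneg) auto
    moreover have "(max_source_power p - P) * (c * D - R * alpha x i) > 0" if "P < max_source_power p"
      using False that by (intro mult_pos_pos) auto
    ultimately show thesis
      using move[of "max_source_power p"] P by (intro that(2)) (auto simp: P_def)
  qed
qed

section \<open>Enjoyers are never optimal\<close>

lemma half_ln_less:
  fixes u :: real
  assumes "u > 0"
  shows "ln (1 + u) / 2 < ln (1 + u / 2)"
proof -
  \<comment> \<open>The square exceeds \<open>1 + u\<close> by \<open>u^2 / 4\<close>.\<close>
  have "ln (1 + u) < ln ((1 + u / 2) ^ 2)"
    using assms by (subst ln_less_cancel_iff) (auto simp: power2_eq_square algebra_simps add_pos_pos)
  also have "\<dots> = 2 * ln (1 + u / 2)"
    using assms by (simp add: ln_realpow)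
  finally show ?thesis by simp
qed

text \<open>Data power enters neither the relay utility nor the time constraints, so halving it at
  one source alters only that source's utility.\<close>

lemma enjoyer_not_optimal:
  assumes p: "valid_params p" and x: "feasible p x" and i: "i \<in> {1..num_pairs p}"
    and enj: "enjoyer x i"
  obtains y where "feasible p y" "objective p x < objective p y"
proof -
  define d where "d = data_power x i"
  define y where "y = set_data x i (d / 2)"
  define u where "u = d * (cmod (gain_sr p i))\<^sup>2 / noise_power p"
  define G where "G = gamma x i * ln (1 + relay_power x * (cmod (gain_rd p i))\<^sup>2 / noise_power p)"
  note pos = feasible_pos[OF x i]
  have d: "d > 0" using pos by (simp add: d_def)
  have u: "u > 0" using pos p d by (simp add: u_def valid_params_def)
  have rx: "rate p x i = min (beta x i * ln (1 + u)) G"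
    by (simp add: rate_def u_def G_def d_def)
  have ry: "rate p y i = min (beta x i * ln (1 + u / 2)) G"
    by (simp add: rate_def u_def G_def y_def mult.commute)
  have "beta x i * (ln (1 + u) / 2) < beta x i * ln (1 + u / 2)"
    using half_ln_less[OF u] pos by simp
  \<comment> \<open>If \<open>G\<close> is the new minimum, half the old rate is at most
    \<open>G / 2\<close>, which is below \<open>G\<close> because a positive rate forces
    \<open>G > 0\<close>.\<close>
  then have rate: "rate p x i / 2 < rate p y i"
    using pos(1) unfolding rx ry by auto
  \<comment> \<open>Without energy transmission the denominator is \<open>d * beta x i\<close>;
    halving numerator and denominator gives both utilities the same denominator, so only numerators
    are compared.\<close>
  have Ux: "source_utility p x i = rate p x i / 2 / (d / 2 * beta x i)"
    using enj by (simp add: source_utility_def enjoyer_def d_def)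
  have Uy: "source_utility p y i = rate p y i / (d / 2 * beta x i)"
    using enj by (simp add: source_utility_def enjoyer_def y_def)
  have U: "source_utility p x i < source_utility p y i"
    unfolding Ux Uy using rate d pos by (intro divide_strict_right_mono) auto
  have Uj: "source_utility p y j = source_utility p x j" if "j \<noteq> i" for j
    using that by (simp add: y_def source_utility_set_data_other)
  have "source_utility p y j > 0" if "j \<in> {1..num_pairs p}" for j
  proof -
    have "source_utility p x j > 0" using x that by (simp add: feasible_def)
    with U Uj[of j] show ?thesis by (cases "j = i") auto
  qed
  moreover have "d \<le> max_source_power p"
    using x i by (auto simp: feasible_def d_def)
  ultimately have "feasible p y"
    using x d by (auto simp: feasible_def y_def)
  moreover have "objective p x < objective p y"
  proof -
    have "(\<Prod>j\<in>{1..num_pairs p} - {i}. source_utility p y j) =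
        (\<Prod>j\<in>{1..num_pairs p} - {i}. source_utility p x j)"
      by (rule prod.cong) (auto simp: Uj)
    moreover have "(\<Prod>j\<in>{1..num_pairs p} - {i}. source_utility p x j) > 0"
      using x by (auto simp: feasible_def intro!: prod_pos)
    moreover have "relay_utility p x > 0" using x by (simp add: feasible_def)
    moreover have "relay_utility p y = relay_utility p x" by (simp add: y_def)
    ultimately show ?thesis
      using U by (simp add: objective_remove[OF i])
  qed
  ultimately show thesis by (rule that)
qed

section \<open>From one source to all sources\<close>

lemma dominated_by_dedicators_or_enjoyers:
  assumes y: "feasible p y"
  obtains z where "feasible p z" "objective p y \<le> objective p z" "all_dedicators_or_enjoyers p z"
proof -
  \<comment> \<open>\<open>A\<close> is the set of sources already moved to an endpoint; moving
    another one leaves their energy powers in place.\<close>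
  have "\<exists>z. feasible p z \<and> objective p y \<le> objective p z \<and>
      (\<forall>i\<in>A. dedicator p z i \<or> enjoyer z i)" if "finite A" "A \<subseteq> {1..num_pairs p}" for A
    using that
  proof (induction A rule: finite_induct)
    case empty
    then show ?case using y by auto
  next
    case (insert i A)
    then obtain z where z: "feasible p z" "objective p y \<le> objective p z"
      "\<forall>i\<in>A. dedicator p z i \<or> enjoyer z i" by auto
    have keep: "\<forall>j\<in>insert i A. dedicator p (set_energy z i q) j \<or> enjoyer (set_energy z i q) j"
      if "q = 0 \<or> q = max_source_power p" for q
      using z that by (auto simp: dedicator_def enjoyer_def)
    have "i \<in> {1..num_pairs p}" using insert.prems by simp
    from z(1) this show ?case
    proof (cases rule: set_energy_endpoint)
      case 1
      then show ?thesis
        using z(2) keep[of 0] by (intro exI[of _ "set_energy z i 0"]) simp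
    next
      case 2
      then show ?thesis
        using z(2) keep[of "max_source_power p"]
        by (intro exI[of _ "set_energy z i (max_source_power p)"]) simp
    qed
  qed
  from this[of "{1..num_pairs p}"] that show thesis
    by (auto simp: all_dedicators_or_enjoyers_def)
qed

lemma nash_bargaining_solution_dedicators_or_enjoyers:
  assumes p: "valid_params p" and x: "nash_bargaining_solution p x"
  shows "all_dedicators_or_enjoyers p x"
  unfolding all_dedicators_or_enjoyers_def
proof (intro ballI, rule ccontr)
  fix i assume i: "i \<in> {1..num_pairs p}" and n: "\<not> (dedicator p x i \<or> enjoyer x i)"
  have f: "feasible p x" and max: "\<And>y. feasible p y \<Longrightarrow> objective p y \<le> objective p x"
    using x by (auto simp: nash_bargaining_solution_def maximizes_on_def)
  have lt: "energy_power x i < max_source_power p"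
    using f i n by (force simp: feasible_def dedicator_def)
  from f i show False
  proof (cases rule: set_energy_endpoint)
    case 1
    \<comment> \<open>The move to 0 may only preserve the objective, so the contradiction comes from
      improving the moved point once more.\<close>
    have "enjoyer (set_energy x i 0) i" by (simp add: enjoyer_def)
    with p 1(1) i obtain y where "feasible p y" "objective p (set_energy x i 0) < objective p y"
      by (rule enjoyer_not_optimal)
    with 1(2) max[of y] show False by simp
  next
    case 2
    with max[of "set_energy x i (max_source_power p)"] lt show False by simp
  qed
qed

text \<open>Endpoint powers alone do not give optimality: if all energy powers are 0, the relay
  harvests nothing and the point is infeasible. The right-hand side therefore also asks for
  optimality among feasible points with endpoint powers. Its converse direction rests on every
  feasible point being dominated by such a point.\<close>

theorem theorem1:
  fixes p :: nbp_params and x :: nbp_vars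
  assumes "valid_params p"
  shows "nash_bargaining_solution p x \<longleftrightarrow>
           all_dedicators_or_enjoyers p x \<and>
           maximizes_on p {y. feasible p y \<and> all_dedicators_or_enjoyers p y} x"
proof
  assume "nash_bargaining_solution p x"
  with nash_bargaining_solution_dedicators_or_enjoyers[OF assms this]
  show "all_dedicators_or_enjoyers p x \<and>
      maximizes_on p {y. feasible p y \<and> all_dedicators_or_enjoyers p y} x"
    by (auto simp: nash_bargaining_solution_def maximizes_on_def)
next
  assume "all_dedicators_or_enjoyers p x \<and>
      maximizes_on p {y. feasible p y \<and> all_dedicators_or_enjoyers p y} x"
  then have f: "feasible p x"
    and max: "\<And>z. feasible p z \<Longrightarrow> all_dedicators_or_enjoyers p z \<Longrightarrow> objective p z \<le> objective p x"
    by (auto simp: maximizes_on_def)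
  have "objective p y \<le> objective p x" if "feasible p y" for y
  proof -
    from that obtain z where "feasible p z" "objective p y \<le> objective p z"
      "all_dedicators_or_enjoyers p z"
      by (rule dominated_by_dedicators_or_enjoyers)
    with max[of z] show ?thesis by simp
  qed
  with f show "nash_bargaining_solution p x"
    by (simp add: nash_bargaining_solution_def maximizes_on_def)
qed

end
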